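(* Let $\Omega$ be a base space of locally integrable matrix functions with its linear skew-product flow $\Psi$ as in the context, and let $\omega\in\Omega$. Suppose that the equation $\dot x=A(\omega_t)x$ has (uniform) $\mu$-dichotomy for some fast growth rate $\mu$ (equivalently, $0\notin\Sigma_{\mu\mathrm{D}}(\omega)$). Then $\mathbb{A}(\omega)=\mathbb{O}(\omega)=\varnothing$, i.e. both the alpha limit set and the omega limit set of $\omega$ are empty.
   Context: Skew-product setting. $\Omega$ is a space of locally integrable functions $\omega:\mathbb{R}\to\mathbb{R}^{N\times N}$, endowed with a topology such that the translation flow $\mathbb{R}\times\Omega\to\Omega$, $(\tau,\omega)\mapsto\omega_\tau$, $\omega_\tau(t)=\omega(t+\tau)$, is well defined and continuous; the evaluation map $A:\Omega\to\mathbb{R}^{N\times N}$, $A(\omega)=\omega(0)$, is continuous (so $A(\omega_t)=\omega(t)$); if $\widehat\omega=\lim_n\omega_{\tau_n}$ in $\Omega$ with $\tau_n\searrow-\infty$ or $\tau_n\nearrow+\infty$, then $\widehat\omega(t)=\lim_n\omega_{\tau_n}(t)$ for almost every $t$; and $(\omega,t,s)\mapsto\Phi_\omega(t,s)$ is jointly continuous, where $\Phi_\omega(t,s)$ denotes the evolution operator of $\dot x=A(\omega_t)x$. The linear skew-product flow is $\Psi:\mathbb{R}\times\Omega\times\mathbb{R}^N\to\Omega\times\mathbb{R}^N$, $\Psi(t,\omega,x)=(\omega_t,\Phi_\omega(t,0)x)$. The alpha limit set $\mathbb{A}(\omega)$ (resp. omega limit set $\mathbb{O}(\omega)$) is the set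 of $\widehat\omega\in\Omega$ for which there is a sequence $\tau_n\searrow-\infty$ (resp. $\tau_n\nearrow+\infty$) with $\widehat\omega=\lim_{n\to\infty}\omega_{\tau_n}$ in $\Omega$. Growth rates. A growth rate is a strictly increasing differentiable function $\mu:\mathbb{R}\to\mathbb{R}^+$ with $\mu(0)=1$, $\lim_{t\to+\infty}\mu(t)=+\infty$, $\lim_{t\to-\infty}\mu(t)=0$. For $r>1$ let $\mathrm{s}_r(t)=e^{\mathrm{sgn}(t)|t|^r}$. The growth rate $\mu$ is fast if there are $r\in(1,+\infty)$ and $M\ge1$ with $\frac{\mathrm{s}_r(t)}{\mathrm{s}_r(s)}\le M\frac{\mu(t)}{\mu(s)}$ for all $t\ge s$. Dichotomy. A linear equation $\dot x=B(t)x$ ($B$ locally integrable) with evolution operator $\Phi$ has (uniform) $\mu$-dichotomy if there are projections $\mathrm{P}(s)\in\mathbb{R}^{N\times N}$, $s\in\mathbb{R}$, with $\mathrm{P}(t)\Phi(t,s)=\Phi(t,s)\mathrm{P}(s)$ for all $t,s$, and constants $K\ge1$, $\alpha<0$, $\beta>0$ such that $\|\Phi(t,s)\mathrm{P}(s)\|\le K(\mu(t)/\mu(s))^\alpha$ for $t\ge s$ and $\|\Phi(t,s)[\mathrm{Id}-\mathrm{P}(s)]\|\le K(\mu(t)/\mu(s))^\beta$ for $t\le s$. For real $\gamma$, $\gamma\in\Sigma_{\mu\mathrm{D}}(\omega)$ means that the shifted equation $\dot y=\big(\omega(t)-\gamma\frac{\dot\mu(t)}{\mu(t)}\mathrm{Id}\big)y$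 does not have $\mu$-dichotomy. *)

theory Defs
  imports "HOL-Analysis.Analysis"
begin

definition locally_integrable :: "(real \<Rightarrow> 'a::euclidean_space) \<Rightarrow> bool" where
  "locally_integrable f \<longleftrightarrow> (\<forall>a b. f absolutely_integrable_on {a..b})"

definition translate :: "real \<Rightarrow> (real \<Rightarrow> 'a) \<Rightarrow> real \<Rightarrow> 'a" where
  "translate \<tau> \<omega> = (\<lambda>t. \<omega> (t + \<tau>))"

definition evaluation :: "(real \<Rightarrow> 'a) \<Rightarrow> 'a" where
  "evaluation \<omega> = \<omega> 0"

text \<open>
  Solutions are understood in the sense of Caratheodory, in integrated form. For locally
  integrable \<open>B\<close> exactly one \<open>\<Phi>\<close> satisfies this predicate; \<open>a\<close>, \<open>b\<close> and \<open>s\<close> are unrelated, so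
  both time directions are covered, and continuity in the first argument is implied.
\<close>

definition is_evolution_operator ::
  "(real \<Rightarrow> real^'n^'n) \<Rightarrow> (real \<Rightarrow> real \<Rightarrow> real^'n^'n) \<Rightarrow> bool" where
  "is_evolution_operator B \<Phi> \<longleftrightarrow>
     (\<forall>s. \<Phi> s s = mat 1) \<and>
     (\<forall>s a b. a \<le> b \<longrightarrow> ((\<lambda>u. B u ** \<Phi> u s) has_integral (\<Phi> b s - \<Phi> a s)) {a..b})"

text \<open>
  \<open>\<Omega>\<close> carries its own topology, with the set of functions as \<open>topspace\<close>; it is not required to
  be Hausdorff or metrizable. \<open>\<Phi> \<omega>\<close> is the evolution operator of \<open>x' = A(\<omega>\<^sub>t) x\<close>.
\<close>

locale base_space =
  fixes \<Omega> :: "(real \<Rightarrow> real^'n^'n) topology"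
    and \<Phi> :: "(real \<Rightarrow> real^'n^'n) \<Rightarrow> real \<Rightarrow> real \<Rightarrow> real^'n^'n"
  assumes locally_integrable:
      "\<And>\<omega>. \<omega> \<in> topspace \<Omega> \<Longrightarrow> locally_integrable \<omega>"
    and continuous_translate:
      "continuous_map (prod_topology euclideanreal \<Omega>) \<Omega> (\<lambda>(\<tau>, \<omega>). translate \<tau> \<omega>)"
    and continuous_evaluation:
      "continuous_map \<Omega> euclidean evaluation"
    and limit_AE:
      "\<And>\<omega> \<omega>' \<tau>.
        \<lbrakk>\<omega> \<in> topspace \<Omega>;
         decseq \<tau> \<and> filterlim \<tau> at_bot sequentially \<or> incseq \<tau> \<and> filterlim \<tau> at_top sequentially;
         limitin \<Omega> (\<lambda>n. translate (\<tau> n) \<omega>) \<omega>' sequentially\<rbrakk>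
        \<Longrightarrow> AE t in lebesgue. (\<lambda>n. translate (\<tau> n) \<omega> t) \<longlonglongrightarrow> \<omega>' t"
    and evolution_operator:
      "\<And>\<omega>. \<omega> \<in> topspace \<Omega> \<Longrightarrow>
        is_evolution_operator (\<lambda>t. evaluation (translate t \<omega>)) (\<Phi> \<omega>)"
    and continuous_evolution_operator:
      "continuous_map (prod_topology \<Omega> (prod_topology euclideanreal euclideanreal)) euclidean
        (\<lambda>(\<omega>, t, s). \<Phi> \<omega> t s)"

definition skew_product_flow ::
  "((real \<Rightarrow> real^'n^'n) \<Rightarrow> real \<Rightarrow> real \<Rightarrow> real^'n^'n) \<Rightarrow>
   real \<times> (real \<Rightarrow> real^'n^'n) \<times> (real^'n) \<Rightarrow> (real \<Rightarrow> real^'n^'n) \<times> (real^'n)" where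
  "skew_product_flow \<Phi> = (\<lambda>(t, \<omega>, x). (translate t \<omega>, \<Phi> \<omega> t 0 *v x))"

definition alpha_limit_set ::
  "(real \<Rightarrow> 'a) topology \<Rightarrow> (real \<Rightarrow> 'a) \<Rightarrow> (real \<Rightarrow> 'a) set" where
  "alpha_limit_set \<Omega> \<omega> =
     {\<omega>' \<in> topspace \<Omega>. \<exists>\<tau>. decseq \<tau> \<and> filterlim \<tau> at_bot sequentially \<and>
        limitin \<Omega> (\<lambda>n. translate (\<tau> n) \<omega>) \<omega>' sequentially}"

definition omega_limit_set ::
  "(real \<Rightarrow> 'a) topology \<Rightarrow> (real \<Rightarrow> 'a) \<Rightarrow> (real \<Rightarrow> 'a) set" where
  "omega_limit_set \<Omega> \<omega> =
     {\<omega>' \<in> topspace \<Omega>. \<exists>\<tau>. incseq \<tau> \<and> filterlim \<tau> at_top sequentially \<and>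
        limitin \<Omega> (\<lambda>n. translate (\<tau> n) \<omega>) \<omega>' sequentially}"

definition growth_rate :: "(real \<Rightarrow> real) \<Rightarrow> bool" where
  "growth_rate \<mu> \<longleftrightarrow>
     (\<forall>t. 0 < \<mu> t) \<and> strict_mono \<mu> \<and> \<mu> differentiable_on UNIV \<and> \<mu> 0 = 1 \<and>
     filterlim \<mu> at_top at_top \<and> (\<mu> \<longlongrightarrow> 0) at_bot"

definition s_rate :: "real \<Rightarrow> real \<Rightarrow> real" where
  "s_rate r t = exp (sgn t * \<bar>t\<bar> powr r)"

definition fast_growth_rate :: "(real \<Rightarrow> real) \<Rightarrow> bool" where
  "fast_growth_rate \<mu> \<longleftrightarrow> growth_rate \<mu> \<and>
     (\<exists>r>1. \<exists>M\<ge>1. \<forall>t s. t \<ge> s \<longrightarrow> s_rate r t / s_rate r s \<le> M * (\<mu> t / \<mu> s))"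

text \<open>
  The library norm on \<open>real^'n^'n\<close> is the Frobenius norm. As all norms on matrices are equivalent
  and \<open>K\<close> is existentially quantified, the notion does not depend on this choice.
\<close>

definition has_mu_dichotomy :: "(real \<Rightarrow> real) \<Rightarrow> (real \<Rightarrow> real^'n^'n) \<Rightarrow> bool" where
  "has_mu_dichotomy \<mu> B \<longleftrightarrow>
     (\<exists>\<Phi>. is_evolution_operator B \<Phi> \<and>
       (\<exists>P K \<alpha> \<beta>.
          (\<forall>s. P s ** P s = P s) \<and>
          (\<forall>t s. P t ** \<Phi> t s = \<Phi> t s ** P s) \<and>
          K \<ge> 1 \<and> \<alpha> < 0 \<and> \<beta> > 0 \<and>
          (\<forall>t s. t \<ge> s \<longrightarrow> norm (\<Phi> t s ** P s) \<le> K * (\<mu> t / \<mu> s) powr \<alpha>) \<and>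
          (\<forall>t s. t \<le> s \<longrightarrow> norm (\<Phi> t s ** (mat 1 - P s)) \<le> K * (\<mu> t / \<mu> s) powr \<beta>)))"

definition mu_dichotomy_spectrum :: "(real \<Rightarrow> real) \<Rightarrow> (real \<Rightarrow> real^'n^'n) \<Rightarrow> real set" where
  "mu_dichotomy_spectrum \<mu> \<omega> =
     {\<gamma>. \<not> has_mu_dichotomy \<mu> (\<lambda>t. \<omega> t - (\<gamma> * (deriv \<mu> t / \<mu> t)) *\<^sub>R mat 1)}"

end

theory Submission
  imports Defs "HOL-Real_Asymp.Real_Asymp"
begin

text \<open>
  Uniqueness of Caratheodory solutions makes \<open>\<Phi> \<omega>\<close> the operator occurring in the dichotomy, gives
  the cocycle identity and turns \<open>\<Phi> (\<omega>\<^sub>\<tau>) t s\<close> into \<open>\<Phi> \<omega> (t + \<tau>) (s + \<tau>)\<close>. If \<open>\<omega>\<close> had a limit point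
  along \<open>\<tau>\<^sub>n \<rightarrow> \<plusminus>\<infinity>\<close>, the one-step operators \<open>\<Phi> \<omega> (\<tau>\<^sub>n + 1) \<tau>\<^sub>n\<close> and their inverses would therefore
  converge. But for a fast rate \<open>\<mu> (t + 1) / \<mu> t \<rightarrow> \<infinity>\<close> as \<open>t \<rightarrow> \<plusminus>\<infinity>\<close>, so the dichotomy forces one step
  forward on the range of \<open>P \<tau>\<^sub>n\<close> and one step backward on the kernel of \<open>P (\<tau>\<^sub>n + 1)\<close> to tend to 0.
  By invariance both \<open>P (\<tau>\<^sub>n + 1)\<close> and its complement tend to 0, which is absurd.
\<close>

section \<open>Matrix products and uniqueness for linear Caratheodory equations\<close>

lemma bounded_bilinear_matrix_matrix_mult:
  "bounded_bilinear ((**) :: real^'n^'m \<Rightarrow> real^'p^'n \<Rightarrow> real^'p^'m)"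
  by (auto simp: bilinear_conv_bounded_bilinear[symmetric] bilinear_def vec_eq_iff
      matrix_matrix_mult_def sum.distrib sum_distrib_left algebra_simps intro!: linearI)

lemma matrix_mult_diff_left:
  fixes A B :: "real^'n^'m" and C :: "real^'p^'n"
  shows "(A - B) ** C = A ** C - B ** C"
  by (rule bounded_bilinear.diff_left[OF bounded_bilinear_matrix_matrix_mult])

lemma matrix_mult_diff_right:
  fixes A :: "real^'n^'m" and B C :: "real^'p^'n"
  shows "A ** (B - C) = A ** B - A ** C"
  by (rule bounded_bilinear.diff_right[OF bounded_bilinear_matrix_matrix_mult])

text \<open>The indefinite integral of the norm is continuous. Since f may be unbounded near t, this
  smallness replaces the sup bound on coefficients in the usual uniqueness proof.\<close>

lemma locally_integrable_norm_small_interval: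
  fixes f :: "real \<Rightarrow> 'a::euclidean_space"
  assumes "locally_integrable f" "0 < \<epsilon>"
  obtains \<delta> where "0 < \<delta>" "integral {t - \<delta>..t + \<delta>} (\<lambda>u. norm (f u)) < \<epsilon>"
proof -
  have int: "(\<lambda>u. norm (f u)) integrable_on {a..b}" for a b
    using assms(1) by (auto simp: locally_integrable_def absolutely_integrable_on_def)
  define F where "F x = integral {t - 1..x} (\<lambda>u. norm (f u))" for x
  have "continuous_on {t - 1..t + 1} F"
    unfolding F_def by (rule indefinite_integral_continuous_1[OF int])
  then obtain d where d: "0 < d"
    "\<And>x. x \<in> {t - 1..t + 1} \<Longrightarrow> dist x t < d \<Longrightarrow> dist (F x) (F t) < \<epsilon> / 2"
    using \<open>0 < \<epsilon>\<close> unfolding continuous_on_iff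
    by (metis (no_types, opaque_lifting) atLeastAtMost_iff diff_add_cancel half_gt_zero
        le_add_same_cancel1 less_eq_real_def le_diff_eq zero_le_one diff_le_eq)
  \<comment> \<open>The cap 1 keeps both t - \<delta> and t + \<delta> in the interval where F is
    known to be continuous.\<close>
  define \<delta> where "\<delta> = min (d / 2) 1"
  have \<delta>: "0 < \<delta>" "\<delta> < d" "\<delta> \<le> 1"
    using d(1) by (auto simp: \<delta>_def)
  have "F (t - \<delta>) + integral {t - \<delta>..t + \<delta>} (\<lambda>u. norm (f u)) = F (t + \<delta>)"
    unfolding F_def using \<delta> by (intro Henstock_Kurzweil_Integration.integral_combine int) auto
  moreover have "dist (F (t - \<delta>)) (F t) < \<epsilon> / 2" "dist (F (t + \<delta>)) (F t) < \<epsilon> / 2"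
    using \<delta> by (intro d(2); simp add: dist_real_def)+
  ultimately have "integral {t - \<delta>..t + \<delta>} (\<lambda>u. norm (f u)) < \<epsilon>"
    unfolding dist_real_def by linarith
  with \<delta>(1) that show thesis by blast
qed

lemma has_integral_increment_continuous:
  fixes X :: "real \<Rightarrow> 'a::banach"
  assumes "\<And>a b. a \<le> b \<Longrightarrow> (g has_integral (X b - X a)) {a..b}"
  shows "continuous_on UNIV X"
proof -
  have "continuous_on {t - 1<..<t + 1} X" for t
  proof -
    have "continuous_on {t - 1..t + 1} (\<lambda>x. X (t - 1) + integral {t - 1..x} g)"
      using assms[of "t - 1" "t + 1"]
      by (intro continuous_intros indefinite_integral_continuous_1) (auto simp: has_integral_integrable)
    moreover have "X (t - 1) + integral {t - 1..x} g = X x" if "x \<in> {t - 1..t + 1}" for x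
      using assms[of "t - 1" x] that by (simp add: integral_unique)
    ultimately have "continuous_on {t - 1..t + 1} X"
      by (rule continuous_on_eq)
    then show ?thesis
      by (rule continuous_on_subset) auto
  qed
  then have "isCont X t" for t
    by (rule continuous_on_interior[of "{t - 1<..<t + 1}"]) auto
  then show ?thesis
    by (simp add: continuous_at_imp_continuous_on)
qed

text \<open>A connectedness argument in place of Gronwall: the zero set is closed by continuity of
  X, and open because near a zero the maximum of the norm of X is bounded by itself times a factor
  below 1.\<close>

lemma linear_equation_zero_unique:
  fixes B :: "real \<Rightarrow> real^'n^'n" and X :: "real \<Rightarrow> real^'m^'n"
  assumes B: "locally_integrable B"
    and X: "\<And>a b. a \<le> b \<Longrightarrow> ((\<lambda>u. B u ** X u) has_integral (X b - X a)) {a..b}"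
    and zero: "X s = 0"
  shows "X t = 0"
proof -
  obtain C where C: "C > 0" "\<And>(M :: real^'n^'n) (Y :: real^'m^'n). norm (M ** Y) \<le> norm M * norm Y * C"
    using bounded_bilinear.pos_bounded[OF bounded_bilinear_matrix_matrix_mult] by blast
  have cont: "continuous_on UNIV X"
    by (rule has_integral_increment_continuous[OF X])
  let ?Z = "{t. X t = 0}"
  have "closed ?Z"
    using continuous_closed_vimage[of "{0}" X] cont
    by (auto simp: vimage_def continuous_on_eq_continuous_at)
  moreover have "open ?Z"
    unfolding open_contains_cball
  proof (intro ballI)
    fix t assume "t \<in> ?Z"
    then have t: "X t = 0" by simp
    obtain \<delta> where \<delta>: "0 < \<delta>" "integral {t - \<delta>..t + \<delta>} (\<lambda>u. norm (B u)) < 1 / C"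
      using locally_integrable_norm_small_interval[OF B, of "1 / C" t] C(1) by auto
    let ?I = "{t - \<delta>..t + \<delta>}" and ?c = "integral {t - \<delta>..t + \<delta>} (\<lambda>u. norm (B u))"
    have int: "(\<lambda>u. norm (B u)) integrable_on {a..b}" for a b
      using B by (auto simp: locally_integrable_def absolutely_integrable_on_def)
    have "compact ?I" "?I \<noteq> {}" using \<delta> by auto
    then obtain p where p: "p \<in> ?I" "\<And>x. x \<in> ?I \<Longrightarrow> norm (X x) \<le> norm (X p)"
      using continuous_attains_sup[of ?I "\<lambda>x. norm (X x)"]
        continuous_on_norm[OF continuous_on_subset[OF cont subset_UNIV]] by blast
    \<comment> \<open>The maximum point p may lie on either side of t; ordering the two endpoints
      treats both time directions at once.\<close>
    let ?a = "min t p" and ?b = "max t p"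
    have sub: "{?a..?b} \<subseteq> ?I" using p(1) \<delta> by auto
    have "norm (X p) = norm (X ?b - X ?a)"
      using t by (auto simp: min_def max_def)
    also have "\<dots> = norm (integral {?a..?b} (\<lambda>u. B u ** X u))"
      by (simp add: integral_unique[OF X] min.coboundedI1)
    also have "\<dots> \<le> integral {?a..?b} (\<lambda>u. (C * norm (X p)) * norm (B u))"
    proof (rule integral_norm_bound_integral)
      show "(\<lambda>u. B u ** X u) integrable_on {?a..?b}"
        by (rule has_integral_integrable[OF X]) (simp add: min.coboundedI1)
      show "(\<lambda>u. (C * norm (X p)) * norm (B u)) integrable_on {?a..?b}"
        by (intro integrable_on_mult_right int)
      fix u assume "u \<in> {?a..?b}"
      then have "norm (X u) \<le> norm (X p)" using sub p(2) by blast
      then have "norm (B u) * norm (X u) * C \<le> norm (B u) * norm (X p) * C"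
        using C(1) by (intro mult_right_mono mult_left_mono) auto
      with C(2)[of "B u" "X u"] show "norm (B u ** X u) \<le> (C * norm (X p)) * norm (B u)"
        by (simp add: mult.commute mult.left_commute)
    qed
    also have "\<dots> = C * norm (X p) * integral {?a..?b} (\<lambda>u. norm (B u))"
      by simp
    also have "\<dots> \<le> C * norm (X p) * ?c"
      using C(1) by (intro mult_left_mono integral_subset_le[OF sub int int]) auto
    finally have le: "norm (X p) * 1 \<le> norm (X p) * (C * ?c)"
      by (simp add: mult.commute mult.left_commute)
    have "C * ?c < 1"
      using \<delta>(2) C(1) by (simp add: field_simps)
    then have "norm (X p) = 0"
      using le by (metis linorder_not_le mult_le_cancel_left_pos norm_le_zero_iff norm_eq_zero)
    then have "?I \<subseteq> ?Z"
      using p(2) by fastforce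
    then show "\<exists>e>0. cball t e \<subseteq> ?Z"
      using \<delta>(1) by (metis cball_eq_atLeastAtMost)
  qed
  ultimately have "?Z = UNIV"
    using zero clopen[of ?Z] by auto
  then show ?thesis by auto
qed

text \<open>As functions of t, both sides solve the same linear equation and agree at t = u.
  Allowing two operators serves two purposes: equal operators give the cocycle identity, and u = s
  gives uniqueness.\<close>

lemma evolution_operator_cocycle:
  assumes B: "locally_integrable B"
    and \<Phi>: "is_evolution_operator B \<Phi>" and \<Psi>: "is_evolution_operator B \<Psi>"
  shows "\<Psi> t u ** \<Phi> u s = \<Phi> t s"
proof -
  define X where "X = (\<lambda>t. \<Psi> t u ** \<Phi> u s - \<Phi> t s)"
  have "X t = 0"
  proof (rule linear_equation_zero_unique[OF B])
    fix a b :: real assume "a \<le> b"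
    then have 1: "((\<lambda>v. B v ** \<Psi> v u) has_integral (\<Psi> b u - \<Psi> a u)) {a..b}"
      and 2: "((\<lambda>v. B v ** \<Phi> v s) has_integral (\<Phi> b s - \<Phi> a s)) {a..b}"
      using \<Phi> \<Psi> by (auto simp: is_evolution_operator_def)
    have "bounded_linear (\<lambda>Y. Y ** \<Phi> u s)"
      by (rule bounded_bilinear.bounded_linear_left[OF bounded_bilinear_matrix_matrix_mult])
    from has_integral_diff[OF has_integral_linear[OF 1 this] 2]
    show "((\<lambda>v. B v ** X v) has_integral (X b - X a)) {a..b}"
      by (simp add: X_def o_def matrix_mult_diff_left matrix_mult_diff_right matrix_mul_assoc
          algebra_simps)
  next
    show "X u = 0"
      using \<Psi> by (simp add: X_def is_evolution_operator_def)
  qed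
  then show ?thesis by (simp add: X_def)
qed

lemma evolution_operator_unique:
  assumes "locally_integrable B" "is_evolution_operator B \<Phi>" "is_evolution_operator B \<Psi>"
  shows "\<Phi> = \<Psi>"
  using evolution_operator_cocycle[OF assms, of _ s s for s] assms(2)
  by (intro ext) (simp add: is_evolution_operator_def)

lemma evolution_operator_translate:
  assumes "is_evolution_operator B \<Phi>"
  shows "is_evolution_operator (translate \<tau> B) (\<lambda>t s. \<Phi> (t + \<tau>) (s + \<tau>))"
  unfolding is_evolution_operator_def translate_def
proof (intro conjI allI impI)
  fix s a b :: real assume "a \<le> b"
  then have "((\<lambda>u. B u ** \<Phi> u (s + \<tau>)) has_integral (\<Phi> (b + \<tau>) (s + \<tau>) - \<Phi> (a + \<tau>) (s + \<tau>)))
      {a + \<tau>..b + \<tau>}"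
    using assms by (auto simp: is_evolution_operator_def)
  then show "((\<lambda>u. B (u + \<tau>) ** \<Phi> (u + \<tau>) (s + \<tau>)) has_integral
      (\<Phi> (b + \<tau>) (s + \<tau>) - \<Phi> (a + \<tau>) (s + \<tau>))) {a..b}"
    using has_integral_shift_real_ivl[of _ _ "a + \<tau>" "b + \<tau>" \<tau>] by fastforce
qed (use assms in \<open>auto simp: is_evolution_operator_def\<close>)

section \<open>One-step growth of fast rates\<close>

text \<open>By the mean value theorem the increment is at least \<open>r * t powr (r - 1)\<close>
  for t > 0. For r = 1 it would stay equal to 1, so this is where fast rates differ from exponential
  ones.\<close>

lemma powr_increment_at_top:
  fixes r :: real
  assumes "1 < r"
  shows "filterlim (\<lambda>t. (t + 1) powr r - t powr r) at_top at_top"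
  using assms by real_asymp

lemma s_rate_step_at_infinity:
  assumes "1 < r"
  shows "filterlim (\<lambda>t. s_rate r (t + 1) / s_rate r t) at_top at_infinity"
  unfolding at_infinity_eq_at_top_bot
proof (rule filterlim_sup)
  have exp_lim: "filterlim (\<lambda>t. exp ((t + 1) powr r - t powr r)) at_top at_top"
    by (rule filterlim_compose[OF exp_at_top powr_increment_at_top[OF assms]])
  show "filterlim (\<lambda>t. s_rate r (t + 1) / s_rate r t) at_top at_top"
  proof (rule filterlim_mono_eventually[OF exp_lim order_refl order_refl])
    show "\<forall>\<^sub>F t in at_top. exp ((t + 1) powr r - t powr r) = s_rate r (t + 1) / s_rate r t"
      using eventually_gt_at_top[of 0]
      by eventually_elim (simp add: s_rate_def exp_diff)
  qed
  \<comment> \<open>Since \<open>s_rate r (- t)\<close> is the reciprocal of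
    \<open>s_rate r t\<close>, the step ratio at t equals the one at - t - 1, which reduces the left
    end to the right one.\<close>
  have "filterlim (\<lambda>t::real. - t - 1) at_top at_bot"
    by real_asymp
  from filterlim_compose[OF exp_lim this]
  have "filterlim (\<lambda>t. exp ((- t) powr r - (- t - 1) powr r)) at_top at_bot"
    by simp
  then show "filterlim (\<lambda>t. s_rate r (t + 1) / s_rate r t) at_top at_bot"
  proof (rule filterlim_mono_eventually[OF _ order_refl order_refl])
    show "\<forall>\<^sub>F t in at_bot. exp ((- t) powr r - (- t - 1) powr r) = s_rate r (t + 1) / s_rate r t"
      \<comment> \<open>Below -1 both t and t + 1 are negative, so both signs are -1.\<close>
      using eventually_gt_at_bot[of "-1"]
      by eventually_elim (simp add: s_rate_def exp_diff[symmetric])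
  qed
qed

lemma fast_growth_rate_step_at_infinity:
  assumes "fast_growth_rate \<mu>"
  shows "filterlim (\<lambda>t. \<mu> (t + 1) / \<mu> t) at_top at_infinity"
proof -
  obtain r M where r: "1 < r" and M: "1 \<le> M"
    and le: "\<And>s t. s \<le> t \<Longrightarrow> s_rate r t / s_rate r s \<le> M * (\<mu> t / \<mu> s)"
    using assms by (auto simp: fast_growth_rate_def)
  have "filterlim (\<lambda>t. (1 / M) * (s_rate r (t + 1) / s_rate r t)) at_top at_infinity"
    using M by (intro filterlim_tendsto_pos_mult_at_top[OF tendsto_const]
        s_rate_step_at_infinity[OF r]) auto
  then show ?thesis
  proof (rule filterlim_at_top_mono)
    show "\<forall>\<^sub>F t in at_infinity. (1 / M) * (s_rate r (t + 1) / s_rate r t) \<le> \<mu> (t + 1) / \<mu> t"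
    proof (intro always_eventually allI)
      fix t
      show "(1 / M) * (s_rate r (t + 1) / s_rate r t) \<le> \<mu> (t + 1) / \<mu> t"
        using mult_left_mono[OF le[of t "t + 1"], of "1 / M"] M by simp
    qed
  qed
qed

section \<open>Dichotomy against convergence of translates\<close>

text \<open>Formulated with \<open>at_infinity\<close> so that one argument covers the alpha and the
  omega limit set.\<close>

lemma (in base_space) no_limit_at_infinity:
  assumes \<omega>: "\<omega> \<in> topspace \<Omega>" and \<mu>: "fast_growth_rate \<mu>" and dich: "has_mu_dichotomy \<mu> \<omega>"
    and \<tau>: "filterlim \<tau> at_infinity sequentially"
  shows "\<not> limitin \<Omega> (\<lambda>n. translate (\<tau> n) \<omega>) \<omega>' sequentially"
proof
  assume lim: "limitin \<Omega> (\<lambda>n. translate (\<tau> n) \<omega>) \<omega>' sequentially"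
  have evo: "is_evolution_operator \<eta> (\<Phi> \<eta>)" if "\<eta> \<in> topspace \<Omega>" for \<eta>
    using evolution_operator[OF that] by (simp add: evaluation_def translate_def)
  have mem: "translate t \<omega> \<in> topspace \<Omega>" for t
    using continuous_translate \<omega> by (auto simp: continuous_map_def Pi_iff)
  note li = locally_integrable[OF \<omega>]
  \<comment> \<open>The dichotomy provides some evolution operator; uniqueness identifies it with
    \<open>\<Phi> \<omega>\<close>.\<close>
  obtain P K \<alpha> \<beta> where inv: "\<And>t s. P t ** \<Phi> \<omega> t s = \<Phi> \<omega> t s ** P s"
    and "\<alpha> < 0" "0 < \<beta>"
    and fwd: "\<And>t s. s \<le> t \<Longrightarrow> norm (\<Phi> \<omega> t s ** P s) \<le> K * (\<mu> t / \<mu> s) powr \<alpha>"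
    and bwd: "\<And>t s. t \<le> s \<Longrightarrow> norm (\<Phi> \<omega> t s ** (mat 1 - P s)) \<le> K * (\<mu> t / \<mu> s) powr \<beta>"
    using dich evolution_operator_unique[OF li evo[OF \<omega>]]
    unfolding has_mu_dichotomy_def by metis
  have \<mu>_pos: "0 < \<mu> t" for t
    using \<mu> by (auto simp: fast_growth_rate_def growth_rate_def)
  have inverse: "\<Phi> \<omega> t s ** \<Phi> \<omega> s t = mat 1" for t s
    using evolution_operator_cocycle[OF li evo[OF \<omega>] evo[OF \<omega>]] evo[OF \<omega>]
    by (simp add: is_evolution_operator_def)
  have \<Phi>_translate: "\<Phi> (translate \<tau> \<omega>) t s = \<Phi> \<omega> (t + \<tau>) (s + \<tau>)" for \<tau> t s
    using evolution_operator_unique[OF locally_integrable[OF mem] evo[OF mem]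
        evolution_operator_translate[OF evo[OF \<omega>]]] by metis
  have conv: "(\<lambda>n. \<Phi> \<omega> (t + \<tau> n) (s + \<tau> n)) \<longlonglongrightarrow> \<Phi> \<omega>' t s" for t s
  proof -
    have "continuous_map \<Omega> (prod_topology \<Omega> (prod_topology euclideanreal euclideanreal))
        (\<lambda>\<eta>. (\<eta>, t, s))"
      by (intro continuous_map_pairedI) auto
    from continuous_map_compose[OF this continuous_evolution_operator]
    have "continuous_map \<Omega> euclidean (\<lambda>\<eta>. \<Phi> \<eta> t s)"
      by (simp add: o_def)
    from continuous_map_limit[OF this lim] show ?thesis
      by (simp add: o_def \<Phi>_translate)
  qed
  have step: "filterlim (\<lambda>n. \<mu> (1 + \<tau> n) / \<mu> (\<tau> n)) at_top sequentially"
    using filterlim_compose[OF fast_growth_rate_step_at_infinity[OF \<mu>] \<tau>]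
    by (simp add: add.commute)
  have fwd0: "(\<lambda>n. \<Phi> \<omega> (1 + \<tau> n) (\<tau> n) ** P (\<tau> n)) \<longlonglongrightarrow> 0"
  proof (rule Lim_null_comparison)
    show "\<forall>\<^sub>F n in sequentially. norm (\<Phi> \<omega> (1 + \<tau> n) (\<tau> n) ** P (\<tau> n))
        \<le> K * (\<mu> (1 + \<tau> n) / \<mu> (\<tau> n)) powr \<alpha>"
      by (intro always_eventually allI fwd) simp
    show "(\<lambda>n. K * (\<mu> (1 + \<tau> n) / \<mu> (\<tau> n)) powr \<alpha>) \<longlonglongrightarrow> 0"
      using tendsto_neg_powr[OF \<open>\<alpha> < 0\<close> step] by (rule tendsto_mult_right_zero)
  qed
  have bwd0: "(\<lambda>n. \<Phi> \<omega> (\<tau> n) (1 + \<tau> n) ** (mat 1 - P (1 + \<tau> n))) \<longlonglongrightarrow> 0"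
  proof (rule Lim_null_comparison)
    \<comment> \<open>Inverting the ratio makes the exponent negative, so the divergence in
      \<open>step\<close> applies again.\<close>
    have "(\<mu> (\<tau> n) / \<mu> (1 + \<tau> n)) powr \<beta> = (\<mu> (1 + \<tau> n) / \<mu> (\<tau> n)) powr (- \<beta>)" for n
      using \<mu>_pos[of "\<tau> n"] \<mu>_pos[of "1 + \<tau> n"]
      by (simp add: powr_minus powr_divide)
    then show "\<forall>\<^sub>F n in sequentially. norm (\<Phi> \<omega> (\<tau> n) (1 + \<tau> n) ** (mat 1 - P (1 + \<tau> n)))
        \<le> K * (\<mu> (1 + \<tau> n) / \<mu> (\<tau> n)) powr (- \<beta>)"
      using bwd[of "\<tau> n" "1 + \<tau> n" for n] by (intro always_eventually) simp
    show "(\<lambda>n. K * (\<mu> (1 + \<tau> n) / \<mu> (\<tau> n)) powr (- \<beta>)) \<longlonglongrightarrow> 0"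
      using tendsto_neg_powr[OF _ step, of "- \<beta>"] \<open>0 < \<beta>\<close> by (intro tendsto_mult_right_zero) simp
  qed
  note mult_lim = bounded_bilinear.tendsto[OF bounded_bilinear_matrix_matrix_mult]
  note zero_simps = bounded_bilinear.zero_left[OF bounded_bilinear_matrix_matrix_mult]
    bounded_bilinear.zero_right[OF bounded_bilinear_matrix_matrix_mult]
  \<comment> \<open>Invariance moves the projection to time 1 + \<tau> n, where the two operators
    cancel. The left side is a null sequence times a convergent one, hence null.\<close>
  have "\<Phi> \<omega> (1 + \<tau> n) (\<tau> n) ** P (\<tau> n) ** \<Phi> \<omega> (\<tau> n) (1 + \<tau> n) = P (1 + \<tau> n)" for n
    by (metis inv inverse matrix_mul_assoc matrix_mul_rid)
  with mult_lim[OF fwd0 conv[of 0 1]] have P_lim: "(\<lambda>n. P (1 + \<tau> n)) \<longlonglongrightarrow> 0"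
    by (simp add: zero_simps)
  have "\<Phi> \<omega> (1 + \<tau> n) (\<tau> n) ** (\<Phi> \<omega> (\<tau> n) (1 + \<tau> n) ** (mat 1 - P (1 + \<tau> n)))
      = mat 1 - P (1 + \<tau> n)" for n
    by (simp add: matrix_mul_assoc inverse)
  with mult_lim[OF conv[of 1 0] bwd0] have "(\<lambda>n. mat 1 - P (1 + \<tau> n)) \<longlonglongrightarrow> 0"
    by (simp add: zero_simps)
  from tendsto_add[OF this P_lim] have "(mat 1 :: real^'n^'n) = 0"
    by (simp add: LIMSEQ_const_iff)
  \<comment> \<open>The all-ones vector is nonzero because index types are nonempty;
    \<open>mat 1\<close> fixes it while 0 annihilates it.\<close>
  then show False
    by (metis (full_types) matrix_vector_mul_lid matrix_vector_mult_0 one_neq_zero one_index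
        zero_index)
qed

theorem theorem4p3:
  fixes \<Omega> :: "(real \<Rightarrow> real^'n^'n) topology"
    and \<Phi> :: "(real \<Rightarrow> real^'n^'n) \<Rightarrow> real \<Rightarrow> real \<Rightarrow> real^'n^'n"
    and \<omega> :: "real \<Rightarrow> real^'n^'n"
    and \<mu> :: "real \<Rightarrow> real"
  assumes "base_space \<Omega> \<Phi>"
    and "\<omega> \<in> topspace \<Omega>"
    and "fast_growth_rate \<mu>"
  shows "(has_mu_dichotomy \<mu> (\<lambda>t. evaluation (translate t \<omega>)) \<longleftrightarrow> 0 \<notin> mu_dichotomy_spectrum \<mu> \<omega>) \<and>
         (has_mu_dichotomy \<mu> (\<lambda>t. evaluation (translate t \<omega>)) \<longrightarrow>
            alpha_limit_set \<Omega> \<omega> = {} \<and> omega_limit_set \<Omega> \<omega> = {})"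
proof -
  interpret base_space \<Omega> \<Phi> by fact
  have eval: "(\<lambda>t. evaluation (translate t \<omega>)) = \<omega>"
    by (simp add: evaluation_def translate_def)
  have "alpha_limit_set \<Omega> \<omega> = {} \<and> omega_limit_set \<Omega> \<omega> = {}" if "has_mu_dichotomy \<mu> \<omega>"
    using no_limit_at_infinity[OF assms(2,3) that]
      filterlim_at_bot_imp_at_infinity filterlim_at_top_imp_at_infinity
    unfolding alpha_limit_set_def omega_limit_set_def by blast
  then show ?thesis
    \<comment> \<open>For \<gamma> = 0 the shift term vanishes, so the equivalence holds by
      unfolding the spectrum.\<close>
    unfolding eval by (simp add: mu_dichotomy_spectrum_def)
qed

end
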